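(* Let $A\in\mathbb{R}^{m\times n}$, $b\in\mathbb{R}^m$, $\lambda>0$, and let $\bar x\in\mathbb{R}^n$ be a solution of $\min_{x\in\mathbb{R}^n}\frac12\|Ax-b\|^2+\lambda\|x\|_1$ with equicorrelation set $J:=\{i\in\{1,\dots,n\}:|A_i^T(b-A\bar x)|=\lambda\}$. Define the set-valued map $T:\mathbb{R}^n\rightrightarrows\mathbb{R}^n$ by $$T(x):=\tfrac1\lambda A^T(Ax-b)+\partial\|\cdot\|_1(x).$$ Then $T$ has closed graph. Moreover, if $A_J$ has full column rank, then $\ker D^*T(\bar x\mid0)=\{0\}$ (i.e. $T$ is metrically regular at $(\bar x,0)$).
   Context: $A_i$ is the $i$th column of $A$, and $A_J$ the submatrix of the columns indexed by $J$. $\partial f(\bar x)=\{v: f(\bar x)+\langle v,x-\bar x\rangle\le f(x)\ \forall x\}$ is the convex subdifferential. The graph of $S:\mathbb{R}^n\rightrightarrows\mathbb{R}^k$ is $\mathrm{gph}\,S=\{(x,y): y\in S(x)\}$. For a set $\Omega$ and $\bar z\in\Omega$: the tangent cone is $T_\Omega(\bar z)=\{w:\exists t_k\downarrow0,\ w_k\to w,\ \bar z+t_kw_k\in\Omega\}$; the regular normal cone is $\hat N_\Omega(\bar z)=\{v:\langle v,w\rangle\le0\ \forall w\in T_\Omega(\bar z)\}$; the limiting normal cone $N_\Omega(\bar z)$ is the set of all limits of $v_k\in\hat N_\Omega(z_k)$ with $z_k\to\bar z$, $z_k\in\Omega$. The coderivative of $S$ at $(\bar x,\bar y)\in\mathrm{gph}\,S$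 is defined by $v\in D^*S(\bar x\mid\bar y)(y)\iff(v,-y)\in N_{\mathrm{gph}\,S}(\bar x,\bar y)$, and $\ker D^*S(\bar x\mid\bar y)=\{y:0\in D^*S(\bar x\mid\bar y)(y)\}$. $S$ is metrically regular at $(\bar x,\bar u)\in\mathrm{gph}\,S$ if there are neighborhoods $V$ of $\bar x$, $W$ of $\bar u$ and $\kappa>0$ with $d_{S^{-1}(u)}(x)\le\kappa\, d_{S(x)}(u)$ for all $x\in V$, $u\in W$, where $d_{\mathcal A}(z)$ is the Euclidean distance from $z$ to $\mathcal A$. *)

theory Defs
  imports "HOL-Analysis.Analysis"
begin

definition graph_of :: "('a \<Rightarrow> 'b set) \<Rightarrow> ('a \<times> 'b) set"
  where "graph_of S = {(x, y). y \<in> S x}"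

definition inverse_map :: "('a \<Rightarrow> 'b set) \<Rightarrow> 'b \<Rightarrow> 'a set"
  where "inverse_map S u = {x. u \<in> S x}"

definition subdifferential :: "('a::real_inner \<Rightarrow> real) \<Rightarrow> 'a \<Rightarrow> 'a set"
  where "subdifferential f x = {v. \<forall>y. f x + inner v (y - x) \<le> f y}"

(* As usual in variational analysis, "t decreases to 0" means that t tends to 0
   through positive values, monotone or not. *)
definition tangent_cone :: "'a::real_inner set \<Rightarrow> 'a \<Rightarrow> 'a set"
  where "tangent_cone \<Omega> z =
    {w. \<exists>(t :: nat \<Rightarrow> real) (w' :: nat \<Rightarrow> 'a).
          (\<forall>k. 0 < t k) \<and> t \<longlonglongrightarrow> 0 \<and> w' \<longlonglongrightarrow> w \<and> (\<forall>k. z + t k *\<^sub>R w' k \<in> \<Omega>)}"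

definition regular_normal_cone :: "'a::real_inner set \<Rightarrow> 'a \<Rightarrow> 'a set"
  where "regular_normal_cone \<Omega> z = {v. \<forall>w \<in> tangent_cone \<Omega> z. inner v w \<le> 0}"

definition limiting_normal_cone :: "'a::real_inner set \<Rightarrow> 'a \<Rightarrow> 'a set"
  where "limiting_normal_cone \<Omega> z =
    {v. \<exists>(z' :: nat \<Rightarrow> 'a) (v' :: nat \<Rightarrow> 'a).
          (\<forall>k. z' k \<in> \<Omega>) \<and> z' \<longlonglongrightarrow> z \<and>
          (\<forall>k. v' k \<in> regular_normal_cone \<Omega> (z' k)) \<and> v' \<longlonglongrightarrow> v}"

definition coderivative ::
    "('a::real_inner \<Rightarrow> 'b::real_inner set) \<Rightarrow> 'a \<Rightarrow> 'b \<Rightarrow> 'b \<Rightarrow> 'a set"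
  where "coderivative S xbar ybar y =
    {v. (v, - y) \<in> limiting_normal_cone (graph_of S) (xbar, ybar)}"

definition ker_coderivative ::
    "('a::real_inner \<Rightarrow> 'b::real_inner set) \<Rightarrow> 'a \<Rightarrow> 'b \<Rightarrow> 'b set"
  where "ker_coderivative S xbar ybar = {y. 0 \<in> coderivative S xbar ybar y}"

(* Extended-real valued, so that the distance to the empty set is infinite;
   the library's infdist would give 0 there. *)
definition set_distance :: "'a::metric_space \<Rightarrow> 'a set \<Rightarrow> ereal"
  where "set_distance z A = (INF a\<in>A. ereal (dist z a))"

definition metrically_regular ::
    "('a::metric_space \<Rightarrow> 'b::metric_space set) \<Rightarrow> 'a \<Rightarrow> 'b \<Rightarrow> bool"
  where "metrically_regular S xbar ubar \<longleftrightarrow>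
    (xbar, ubar) \<in> graph_of S \<and>
    (\<exists>V W. \<exists>\<kappa>::real. open V \<and> xbar \<in> V \<and> open W \<and> ubar \<in> W \<and> 0 < \<kappa> \<and>
       (\<forall>x\<in>V. \<forall>u\<in>W.
          set_distance x (inverse_map S u) \<le> ereal \<kappa> * set_distance u (S x)))"

definition l1_norm :: "real ^ 'n \<Rightarrow> real"
  where "l1_norm x = (\<Sum>i\<in>UNIV. \<bar>x $ i\<bar>)"

definition lasso_objective ::
    "real ^ 'n ^ 'm \<Rightarrow> real ^ 'm \<Rightarrow> real \<Rightarrow> real ^ 'n \<Rightarrow> real"
  where "lasso_objective A b lam x = 1 / 2 * (norm (A *v x - b))\<^sup>2 + lam * l1_norm x"

definition equicorrelation_set ::
    "real ^ 'n ^ 'm \<Rightarrow> real ^ 'm \<Rightarrow> real \<Rightarrow> real ^ 'n \<Rightarrow> 'n set"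
  where "equicorrelation_set A b lam x = {i. \<bar>inner (column i A) (b - A *v x)\<bar> = lam}"

(* The submatrix of the columns indexed by J has rank equal to its number of
   columns, card J; repeated columns are thereby excluded. *)
definition full_column_rank_on :: "real ^ 'n ^ 'm \<Rightarrow> 'n set \<Rightarrow> bool"
  where "full_column_rank_on A J \<longleftrightarrow> dim ((\<lambda>i. column i A) ` J) = card J"

definition lasso_map ::
    "real ^ 'n ^ 'm \<Rightarrow> real ^ 'm \<Rightarrow> real \<Rightarrow> real ^ 'n \<Rightarrow> (real ^ 'n) set"
  where "lasso_map A b lam x =
    {(1 / lam) *\<^sub>R (transpose A *v (A *v x - b)) + v | v. v \<in> subdifferential l1_norm x}"

end

theory Submission
  imports Defs
begin

text \<open>
  Write \<open>g x = A\<^sup>T (A x - b) / lam\<close>, so that \<open>u \<in> T x\<close> means that \<open>u - g x\<close> is a subgradient of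
  the l1 norm at \<open>x\<close>. This condition is a family of closed inequalities in \<open>(x, u)\<close>, hence the graph
  of \<open>T\<close> is closed.

  Metric regularity is proved directly. At the solution, the components of \<open>g xbar\<close> outside \<open>J\<close> have
  modulus less than 1. By continuity the same holds for \<open>u - g x\<close> whenever \<open>(x, u)\<close> is close to
  \<open>(xbar, 0)\<close>, and if \<open>(x, u)\<close> is in the graph this forces \<open>x\<close> to vanish outside \<open>J\<close>
  (\<open>support_near_solution\<close>). On vectors supported in \<open>J\<close> the matrix is bounded below, so the
  monotonicity estimate \<open>\<parallel>A (x - x')\<parallel>\<^sup>2 \<le> lam * inner (u - u') (x - x')\<close> (\<open>lasso_map_monotone\<close>) becomes
  \<open>\<parallel>x - x'\<parallel> \<le> (lam / c\<^sup>2) \<parallel>u - u'\<parallel>\<close> on the graph near \<open>(xbar, 0)\<close>: the inverse of \<open>T\<close> is locally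
  single-valued and Lipschitz. That it has a value near \<open>xbar\<close> for every small \<open>u\<close>
  (\<open>perturbed_solution\<close>) follows by minimising the objective minus \<open>lam * inner u x\<close> over a small
  closed ball: since \<open>xbar\<close> is the only minimiser of the unperturbed objective (\<open>solution_unique\<close>),
  that objective exceeds its minimum by a positive amount on the sphere, and the minimiser of the
  perturbed one must be interior.

  The kernel statement is then a consequence of metric regularity, for arbitrary set-valued maps
  between Euclidean spaces (\<open>ker_coderivative_of_metrically_regular\<close>): every direction \<open>d\<close> in the range
  lifts to a tangent direction \<open>(w, d)\<close> of the graph with \<open>norm w \<le> 2 * \<kappa> * norm d\<close>, at all points of
  the graph close to the reference point. Testing regular normals \<open>(v, -y)\<close> against the lift of \<open>-y\<close>
  gives \<open>norm y \<le> 2 * \<kappa> * norm v\<close>, an estimate that survives the passage to limiting normals.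
\<close>

section \<open>Trivial coderivative kernel from metric regularity\<close>

lemma zero_mem_ker_coderivative:
  assumes "(x, u) \<in> graph_of S"
  shows "0 \<in> ker_coderivative S x u"
proof -
  have "(0, 0) \<in> limiting_normal_cone (graph_of S) (x, u)"
    unfolding limiting_normal_cone_def regular_normal_cone_def
    using assms
    by (intro CollectI exI[of _ "\<lambda>_. (x, u)"] exI[of _ "\<lambda>_. 0"]) (auto simp flip: zero_prod_def)
  then show ?thesis
    by (simp add: ker_coderivative_def coderivative_def)
qed

lemma set_distance_less_obtains:
  assumes "set_distance z B < ereal r"
  obtains a where "a \<in> B" "dist z a < r"
  using assms by (auto simp: set_distance_def INF_less_iff)

text \<open>
  Under the metric regularity estimate at \<open>x\<close>, every direction \<open>d\<close> in the range is the second
  component of a tangent to the graph with a controlled first component. Points \<open>y n\<close> with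
  \<open>u + t n *\<^sub>R d \<in> S (y n)\<close> exist within \<open>2 * \<kappa> * t n * norm d\<close> of \<open>x\<close>; the factor 2 makes up for the
  distance to \<open>inverse_map S\<close> being an infimum that need not be attained. The difference quotients
  are bounded, and \<open>w\<close> is a cluster point of them.
\<close>
lemma tangent_direction_of_regular:
  fixes S :: "'a::euclidean_space \<Rightarrow> 'b::euclidean_space set"
  assumes gph: "(x, u) \<in> graph_of S" and W: "open W" "u \<in> W" and "0 < \<kappa>"
    and reg: "\<And>u. u \<in> W \<Longrightarrow> set_distance x (inverse_map S u) \<le> ereal \<kappa> * set_distance u (S x)"
    and d: "d \<noteq> 0"
  obtains w where "(w, d) \<in> tangent_cone (graph_of S) (x, u)" "norm w \<le> 2 * \<kappa> * norm d"
proof -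
  obtain e where e: "e > 0" "ball u e \<subseteq> W"
    using W open_contains_ball by blast
  \<comment> \<open>The shift by 2 keeps \<open>u + t n *\<^sub>R d\<close> strictly inside the ball already for \<open>n = 0\<close>.\<close>
  define t where "t n = e / (norm d * (real n + 2))" for n
  have t_pos: "t n > 0" for n
    using e d by (simp add: t_def)
  have t_lim: "t \<longlonglongrightarrow> 0"
    unfolding t_def using d by real_asymp
  have "\<exists>x'. x' \<in> inverse_map S (u + t n *\<^sub>R d) \<and> dist x x' < 2 * \<kappa> * (t n * norm d)" for n
  proof -
    have pos: "t n * norm d > 0"
      using t_pos d by simp
    have "t n * norm d = e / (real n + 2)"
      using d by (simp add: t_def)
    also have "\<dots> < e"
      using e mult_strict_left_mono[of 1 "real n + 2" e] by (simp add: divide_less_eq)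
    finally have "u + t n *\<^sub>R d \<in> W"
      using e t_pos[of n] by (auto simp: dist_norm subset_iff)
    then have "set_distance x (inverse_map S (u + t n *\<^sub>R d))
        \<le> ereal \<kappa> * set_distance (u + t n *\<^sub>R d) (S x)"
      by (rule reg)
    also have "\<dots> \<le> ereal \<kappa> * ereal (dist (u + t n *\<^sub>R d) u)"
      using gph \<open>0 < \<kappa>\<close>
      by (intro ereal_mult_left_mono) (auto simp: set_distance_def graph_of_def intro: INF_lower)
    also have "\<dots> = ereal (\<kappa> * (t n * norm d))"
      using t_pos[of n] by (simp add: dist_norm)
    also have "\<dots> < ereal (2 * \<kappa> * (t n * norm d))"
      using mult_pos_pos[OF \<open>0 < \<kappa>\<close> pos] by (simp only: less_ereal.simps)
    finally show ?thesis
      using set_distance_less_obtains by blast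
  qed
  then obtain y where y: "\<And>n. u + t n *\<^sub>R d \<in> S (y n)"
    "\<And>n. dist x (y n) < 2 * \<kappa> * (t n * norm d)"
    unfolding inverse_map_def by (metis mem_Collect_eq)
  define w' where "w' n = (1 / t n) *\<^sub>R (y n - x)" for n
  have w'_le: "norm (w' n) \<le> 2 * \<kappa> * norm d" for n
  proof -
    have "norm (w' n) = dist x (y n) / t n"
      using t_pos[of n] by (simp add: w'_def dist_norm norm_minus_commute del: scaleR_diff_right)
    also have "\<dots> \<le> 2 * \<kappa> * norm d"
      using y(2)[of n] t_pos[of n] by (simp add: divide_le_eq mult_ac)
    finally show ?thesis .
  qed
  then have "\<forall>n. w' n \<in> cball 0 (2 * \<kappa> * norm d)"
    by simp
  then obtain w r where w: "w \<in> cball 0 (2 * \<kappa> * norm d)" and r: "strict_mono r"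
    and lim: "(w' \<circ> r) \<longlonglongrightarrow> w"
    using compact_cball[of "0::'a"] unfolding compact_def by meson
  have "(w, d) \<in> tangent_cone (graph_of S) (x, u)"
    unfolding tangent_cone_def
  proof (intro CollectI exI conjI)
    show "\<forall>k. 0 < (t \<circ> r) k"
      using t_pos by simp
    show "(t \<circ> r) \<longlonglongrightarrow> 0"
      using t_lim r by (rule LIMSEQ_subseq_LIMSEQ)
    show "(\<lambda>k. ((w' \<circ> r) k, d)) \<longlonglongrightarrow> (w, d)"
      using lim by (intro tendsto_Pair tendsto_const)
    have "x + t n *\<^sub>R w' n = y n" for n
      using t_pos[of n] by (simp add: w'_def)
    then show "\<forall>k. (x, u) + (t \<circ> r) k *\<^sub>R ((w' \<circ> r) k, d) \<in> graph_of S"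
      using y(1) by (simp add: graph_of_def)
  qed
  then show ?thesis
    using w that by simp
qed

proposition ker_coderivative_of_metrically_regular:
  fixes S :: "'a::euclidean_space \<Rightarrow> 'b::euclidean_space set"
  assumes "metrically_regular S xbar ubar"
  shows "ker_coderivative S xbar ubar = {0}"
proof -
  obtain V W \<kappa> where gph: "(xbar, ubar) \<in> graph_of S"
    and V: "open V" "xbar \<in> V" and W: "open W" "ubar \<in> W" and \<kappa>: "0 < \<kappa>"
    and reg: "\<And>x u. x \<in> V \<Longrightarrow> u \<in> W \<Longrightarrow>
          set_distance x (inverse_map S u) \<le> ereal \<kappa> * set_distance u (S x)"
    using assms unfolding metrically_regular_def by blast
  have "y = 0" if y: "y \<in> ker_coderivative S xbar ubar" for y
  proof -
    obtain z' v' where z': "\<And>k. z' k \<in> graph_of S" "z' \<longlonglongrightarrow> (xbar, ubar)"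
      and v': "\<And>k. v' k \<in> regular_normal_cone (graph_of S) (z' k)" "v' \<longlonglongrightarrow> (0, - y)"
      using y unfolding ker_coderivative_def coderivative_def limiting_normal_cone_def by blast
    have "open (V \<times> W)" "(xbar, ubar) \<in> V \<times> W"
      using V W by (auto intro: open_Times)
    then have "eventually (\<lambda>k. z' k \<in> V \<times> W) sequentially"
      using z'(2) by (rule topological_tendstoD[rotated])
    then have "eventually (\<lambda>k. norm (snd (v' k)) \<le> 2 * \<kappa> * norm (fst (v' k))) sequentially"
    proof eventually_elim
      case (elim k)
      show ?case
      proof (cases "snd (v' k) = 0")
        case False
        obtain x u where xu: "z' k = (x, u)" by force
        with elim have "x \<in> V" "u \<in> W" by auto
        obtain w where w: "(w, snd (v' k)) \<in> tangent_cone (graph_of S) (x, u)"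
          "norm w \<le> 2 * \<kappa> * norm (snd (v' k))"
          using tangent_direction_of_regular[OF _ W(1) \<open>u \<in> W\<close> \<kappa> reg[OF \<open>x \<in> V\<close>] False]
            z'(1)[of k] xu by metis
        \<comment> \<open>With \<open>v' k = (v, -y)\<close>, the tangent \<open>(w, -y)\<close> gives \<open>(norm y)\<^sup>2 \<le> - inner v w\<close>.\<close>
        have "inner (v' k) (w, snd (v' k)) \<le> 0"
          using v'(1)[of k] w(1) xu by (auto simp: regular_normal_cone_def)
        then have "norm (snd (v' k)) * norm (snd (v' k)) \<le> - inner (fst (v' k)) w"
          by (simp add: inner_prod_def dot_square_norm power2_eq_square)
        also have "\<dots> \<le> norm (fst (v' k)) * norm w"
          using Cauchy_Schwarz_ineq2[of "fst (v' k)" w] by linarith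
        also have "\<dots> \<le> norm (fst (v' k)) * (2 * \<kappa> * norm (snd (v' k)))"
          using w(2) by (rule mult_left_mono) simp
        finally have "norm (snd (v' k)) * norm (snd (v' k))
            \<le> (2 * \<kappa> * norm (fst (v' k))) * norm (snd (v' k))"
          by (simp add: mult_ac)
        then show ?thesis
          using False by (subst (asm) mult_le_cancel_right) auto
      qed (use \<kappa> in simp)
    qed
    moreover have "(\<lambda>k. norm (snd (v' k))) \<longlonglongrightarrow> norm (snd ((0::'a), - y))"
      "(\<lambda>k. 2 * \<kappa> * norm (fst (v' k))) \<longlonglongrightarrow> 2 * \<kappa> * norm (fst ((0::'a), - y))"
      using v'(2) by (auto intro!: tendsto_intros tendsto_fst tendsto_snd simp del: fst_conv snd_conv)
    ultimately have "norm (snd ((0::'a), - y)) \<le> 2 * \<kappa> * norm (fst ((0::'a), - y))"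
      using tendsto_le sequentially_bot by blast
    then show ?thesis by simp
  qed
  then show ?thesis
    using zero_mem_ker_coderivative[OF gph] by blast
qed

section \<open>Subgradients of the l1 norm\<close>

lemma subdifferential_monotone:
  assumes "v \<in> subdifferential f x" "v' \<in> subdifferential f x'"
  shows "0 \<le> inner (v - v') (x - x')"
proof -
  have "f x + inner v (x' - x) \<le> f x'" "f x' + inner v' (x - x') \<le> f x"
    using assms by (auto simp: subdifferential_def)
  then show ?thesis
    by (simp add: inner_diff_left inner_diff_right)
qed

lemma subdifferential_l1_norm_component:
  assumes "v \<in> subdifferential l1_norm x"
  shows "v $ i \<in> subdifferential abs (x $ i)"
proof -
  have "\<bar>x $ i\<bar> + inner (v $ i) (s - x $ i) \<le> \<bar>s\<bar>" for s
  proof -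
    let ?y = "x + axis i (s - x $ i)"
    have "l1_norm x + inner v (?y - x) \<le> l1_norm ?y"
      using assms unfolding subdifferential_def by blast
    moreover have "inner v (?y - x) = inner (v $ i) (s - x $ i)"
      by (simp add: inner_axis)
    moreover have "l1_norm ?y - l1_norm x = \<bar>s\<bar> - \<bar>x $ i\<bar>"
    proof -
      have "l1_norm ?y - l1_norm x = (\<Sum>j\<in>UNIV. if j = i then \<bar>s\<bar> - \<bar>x $ i\<bar> else 0)"
        unfolding l1_norm_def sum_subtractf[symmetric]
        by (intro sum.cong) (auto simp: axis_def)
      then show ?thesis by simp
    qed
    ultimately show ?thesis by linarith
  qed
  then show ?thesis by (simp add: subdifferential_def)
qed

lemma subdifferential_abs:
  fixes v x :: real
  assumes "v \<in> subdifferential abs x"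
  shows "\<bar>v\<bar> \<le> 1" "v * x = \<bar>x\<bar>"
proof -
  have h: "\<bar>x\<bar> + v * (s - x) \<le> \<bar>s\<bar>" for s
    using assms by (simp add: subdifferential_def)
  show "\<bar>v\<bar> \<le> 1"
    using h[of "x + 1"] h[of "x - 1"] by simp
  show "v * x = \<bar>x\<bar>"
    using h[of 0] h[of "2 * x"] by simp
qed

text \<open>Complementary slackness.\<close>
lemma subdifferential_l1_norm_strict:
  assumes "v \<in> subdifferential l1_norm x" "\<bar>v $ i\<bar> < 1"
  shows "x $ i = 0"
proof (rule ccontr)
  assume "x $ i \<noteq> 0"
  have "\<bar>x $ i\<bar> = \<bar>v $ i\<bar> * \<bar>x $ i\<bar>"
    using subdifferential_abs(2)[OF subdifferential_l1_norm_component[OF assms(1)], of i]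
    by (metis abs_abs abs_mult)
  with assms(2) \<open>x $ i \<noteq> 0\<close> show False by simp
qed

lemma l1_norm_convex_combination:
  assumes "0 \<le> t" "t \<le> 1"
  shows "l1_norm (x + t *\<^sub>R (y - x)) \<le> l1_norm x + t * (l1_norm y - l1_norm x)"
proof -
  have "\<bar>(x + t *\<^sub>R (y - x)) $ i\<bar> \<le> \<bar>x $ i\<bar> + t * (\<bar>y $ i\<bar> - \<bar>x $ i\<bar>)" for i
  proof -
    have "\<bar>(x + t *\<^sub>R (y - x)) $ i\<bar> = \<bar>(1 - t) * x $ i + t * y $ i\<bar>"
      by (simp add: algebra_simps)
    also have "\<dots> \<le> (1 - t) * \<bar>x $ i\<bar> + t * \<bar>y $ i\<bar>"
      using assms abs_triangle_ineq[of "(1 - t) * x $ i" "t * y $ i"] by (simp add: abs_mult)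
    finally show ?thesis by (simp add: algebra_simps)
  qed
  then have "l1_norm (x + t *\<^sub>R (y - x)) \<le> (\<Sum>i\<in>UNIV. \<bar>x $ i\<bar> + t * (\<bar>y $ i\<bar> - \<bar>x $ i\<bar>))"
    unfolding l1_norm_def by (intro sum_mono)
  then show ?thesis
    by (simp add: l1_norm_def sum.distrib sum_subtractf flip: sum_distrib_left)
qed

lemma continuous_on_l1_norm [continuous_intros]:
  assumes "continuous_on S f"
  shows "continuous_on S (\<lambda>x. l1_norm (f x))"
  unfolding l1_norm_def using assms by (intro continuous_intros)

section \<open>The lasso map\<close>

text \<open>
  The single-valued part of \<open>lasso_map\<close>: the gradient of the least-squares term of the objective,
  divided by \<open>lam\<close>.
\<close>
definition lasso_gradient :: "real ^ 'n ^ 'm \<Rightarrow> real ^ 'm \<Rightarrow> real \<Rightarrow> real ^ 'n \<Rightarrow> real ^ 'n"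
  where "lasso_gradient A b lam x = (1 / lam) *\<^sub>R (transpose A *v (A *v x - b))"

lemma mem_lasso_map_iff:
  "u \<in> lasso_map A b lam x \<longleftrightarrow> u - lasso_gradient A b lam x \<in> subdifferential l1_norm x"
  unfolding lasso_map_def lasso_gradient_def
  by (auto simp: algebra_simps intro!: exI[of _ "u - (1 / lam) *\<^sub>R (transpose A *v (A *v x - b))"])

lemma inner_lasso_gradient:
  assumes "lam \<noteq> 0"
  shows "lam * inner (lasso_gradient A b lam x) h = inner (A *v x - b) (A *v h)"
  using assms dot_lmul_matrix[of "A *v x - b" A h]
  by (simp add: lasso_gradient_def matrix_vector_mul_assoc)

lemma lasso_gradient_component:
  "lasso_gradient A b lam x $ i = - (inner (column i A) (b - A *v x) / lam)"
  by (simp add: lasso_gradient_def matrix_vector_mult_def transpose_def column_def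
      inner_vec_def sum_subtractf sum_negf[symmetric] algebra_simps sum_divide_distrib diff_divide_distrib)

lemma continuous_on_lasso_gradient [continuous_intros]:
  assumes "continuous_on S f"
  shows "continuous_on S (\<lambda>x. lasso_gradient A b lam (f x))"
  unfolding lasso_gradient_def using assms
  by (intro continuous_intros matrix_vector_mult_linear_continuous_on[THEN continuous_on_compose2])
    auto

lemma closed_graph_lasso_map: "closed (graph_of (lasso_map A b lam))"
proof -
  have "graph_of (lasso_map A b lam) = {z. \<forall>y. l1_norm (fst z)
      + inner (snd z - lasso_gradient A b lam (fst z)) (y - fst z) \<le> l1_norm y}"
    by (auto simp: graph_of_def mem_lasso_map_iff subdifferential_def)
  also have "closed \<dots>"
    by (intro closed_Collect_all closed_Collect_le continuous_intros)
  finally show ?thesis .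
qed

lemma lasso_objective_add:
  assumes "lam \<noteq> 0"
  shows "lasso_objective A b lam (x + h) = lasso_objective A b lam x
    + lam * inner (lasso_gradient A b lam x) h + lam * (l1_norm (x + h) - l1_norm x)
    + (norm (A *v h))\<^sup>2 / 2"
proof -
  have "(norm (A *v (x + h) - b))\<^sup>2 = (norm ((A *v x - b) + A *v h))\<^sup>2"
    by (simp add: matrix_vector_right_distrib algebra_simps)
  also have "\<dots> = (norm (A *v x - b))\<^sup>2 + 2 * inner (A *v x - b) (A *v h) + (norm (A *v h))\<^sup>2"
    by (simp add: power2_norm_eq_inner inner_add_left inner_add_right inner_commute)
  finally show ?thesis
    by (simp add: lasso_objective_def inner_lasso_gradient[OF assms] algebra_simps)
qed

text \<open>
  Fermat's rule for the objective perturbed by a linear term. Along the segment from \<open>x\<close> to \<open>y\<close>,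
  the quadratic term is of second order in \<open>t\<close> and disappears after division by \<open>t\<close> as \<open>t\<close> tends to
  0, while convexity bounds the change of the l1 norm by a linear term. A local minimum is therefore
  enough to obtain the subgradient inequality at every \<open>y\<close>.
\<close>
lemma lasso_map_of_local_minimum:
  assumes "0 < lam" "0 < e"
    and min: "\<And>y. dist x y < e \<Longrightarrow> lasso_objective A b lam x - lam * inner u x
      \<le> lasso_objective A b lam y - lam * inner u y"
  shows "u \<in> lasso_map A b lam x"
  unfolding mem_lasso_map_iff subdifferential_def
proof (intro CollectI allI)
  fix y
  define h where "h = y - x"
  define c where "c = inner (lasso_gradient A b lam x - u) h + (l1_norm y - l1_norm x)"
  have ev: "eventually (\<lambda>t. 0 \<le> lam * c + t * ((norm (A *v h))\<^sup>2 / 2)) (at_right 0)"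
  proof -
    have "((\<lambda>t. dist x (x + t *\<^sub>R h)) \<longlongrightarrow> dist x (x + 0 *\<^sub>R h)) (at_right 0)"
      by (intro tendsto_intros)
    then have "eventually (\<lambda>t. dist x (x + t *\<^sub>R h) < e) (at_right 0)"
      using \<open>0 < e\<close> by (intro order_tendstoD(2)[where a = e]) simp_all
    moreover have "eventually (\<lambda>t. t \<in> {0<..<1::real}) (at_right 0)"
      by (rule eventually_at_right_real) simp
    ultimately show ?thesis
    proof eventually_elim
      case (elim t)
      have "0 \<le> lasso_objective A b lam (x + t *\<^sub>R h) - lasso_objective A b lam x
          - lam * inner u (t *\<^sub>R h)"
        using min[OF elim(1)] by (simp add: algebra_simps inner_add_right)
      also have "\<dots> \<le> t * (lam * c + t * ((norm (A *v h))\<^sup>2 / 2))"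
      proof -
        have "lam * (l1_norm (x + t *\<^sub>R h) - l1_norm x) \<le> lam * (t * (l1_norm y - l1_norm x))"
          using l1_norm_convex_combination[of t x y] elim(2) \<open>0 < lam\<close>
          by (intro mult_left_mono) (auto simp: h_def)
        then show ?thesis
          using \<open>0 < lam\<close>
          by (simp add: lasso_objective_add c_def inner_diff_left power2_eq_square algebra_simps
              matrix_vector_mult_scaleR)
      qed
      finally show ?case
        using elim(2) by (simp add: zero_le_mult_iff)
    qed
  qed
  have "((\<lambda>t. lam * c + t * ((norm (A *v h))\<^sup>2 / 2))
      \<longlongrightarrow> lam * c + 0 * ((norm (A *v h))\<^sup>2 / 2)) (at_right 0)"
    by (intro tendsto_intros)
  then have "0 \<le> lam * c + 0 * ((norm (A *v h))\<^sup>2 / 2)"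
    by (rule tendsto_lowerbound[OF _ ev]) simp
  then have "0 \<le> c"
    using \<open>0 < lam\<close> by (simp add: zero_le_mult_iff)
  then show "l1_norm x + inner (u - lasso_gradient A b lam x) (y - x) \<le> l1_norm y"
    by (simp add: c_def h_def inner_diff_left)
qed

text \<open>
  The subdifferential contributes a nonnegative amount, so the linear part alone yields the lower
  bound.
\<close>
lemma lasso_map_monotone:
  assumes "0 < lam" "u \<in> lasso_map A b lam x" "u' \<in> lasso_map A b lam x'"
  shows "(norm (A *v (x - x')))\<^sup>2 \<le> lam * inner (u - u') (x - x')"
proof -
  let ?g = "lasso_gradient A b lam"
  have "0 \<le> inner ((u - ?g x) - (u' - ?g x')) (x - x')"
    using assms by (auto simp: mem_lasso_map_iff intro: subdifferential_monotone)
  then have "0 \<le> lam * (inner (u - u') (x - x') - inner (?g x - ?g x') (x - x'))"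
    using assms(1) by (intro mult_nonneg_nonneg) (simp_all add: inner_diff_left)
  moreover have "lam * inner (?g x - ?g x') (x - x') = (norm (A *v (x - x')))\<^sup>2"
    using assms(1)
    by (simp add: inner_diff_left right_diff_distrib inner_lasso_gradient
        power2_norm_eq_inner matrix_vector_mult_diff_distrib)
  ultimately show ?thesis
    by (simp add: right_diff_distrib)
qed

section \<open>Injectivity on the equicorrelation set\<close>

text \<open>
  Since the dimension of the span of the columns equals \<open>card J\<close> and not merely the number of distinct
  columns, the columns indexed by \<open>J\<close> are distinct and independent.
\<close>
lemma full_column_rank_on_kernel:
  assumes "full_column_rank_on A J" "\<And>i. i \<notin> J \<Longrightarrow> x $ i = 0" "A *v x = 0"
  shows "x = 0"
proof -
  let ?c = "\<lambda>i. column i A"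
  have fin: "finite J" by simp
  have dim: "dim (?c ` J) = card J"
    using assms(1) by (simp add: full_column_rank_on_def)
  have "dim (?c ` J) \<le> card (?c ` J)"
    by (rule dim_le_card') simp
  then have card: "card (?c ` J) = card J"
    using dim card_image_le[OF fin, of ?c] by simp
  then have inj: "inj_on ?c J"
    by (rule eq_card_imp_inj_on[OF fin])
  have indep: "independent (?c ` J)"
    using card dim by (intro card_le_dim_spanning[of _ "span (?c ` J)"]) (auto intro: span_base)
  have "(\<Sum>i\<in>J. x $ i *\<^sub>R ?c i) = A *v x"
    unfolding matrix_mult_sum using assms(2)
    by (intro sum.mono_neutral_cong_left) (auto simp: scalar_mult_eq_scaleR)
  also note assms(3)
  finally have "(\<Sum>v\<in>?c ` J. x $ the_inv_into J ?c v *\<^sub>R v) = 0"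
    by (simp add: sum.reindex[OF inj] the_inv_into_f_f[OF inj])
  then have "x $ the_inv_into J ?c v = 0" if "v \<in> ?c ` J" for v
    using independentD[OF indep, of "?c ` J" "\<lambda>v. x $ the_inv_into J ?c v" v] that by simp
  then have "x $ i = 0" if "i \<in> J" for i
    using the_inv_into_f_f[OF inj that] that by (metis imageI)
  then have "x $ i = 0" for i
    using assms(2) by blast
  then show ?thesis by (simp add: vec_eq_iff)
qed

lemma full_column_rank_on_bounded_below:
  fixes A :: "real ^ 'n ^ 'm"
  assumes "full_column_rank_on A J"
  obtains c where "0 < c" "\<And>x. (\<And>i. i \<notin> J \<Longrightarrow> x $ i = 0) \<Longrightarrow> c * norm x \<le> norm (A *v x)"
proof -
  let ?s = "{x :: real ^ 'n. \<forall>i. i \<notin> J \<longrightarrow> x $ i = 0}"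
  have s: "subspace ?s"
    by (auto simp: subspace_def)
  have "\<exists>e>0. \<forall>x\<in>?s. norm (A *v x) \<ge> e * norm x"
    by (rule injective_imp_isometric[OF closed_subspace[OF s] s])
      (use full_column_rank_on_kernel[OF assms] in auto)
  then show ?thesis
    using that by blast
qed

section \<open>Local behaviour at a solution\<close>

text \<open>
  A point satisfying the optimality condition \<open>0 \<in> T xbar\<close>, with the columns of its equicorrelation
  set \<open>J\<close> linearly independent.
\<close>
locale lasso_solution =
  fixes A :: "real ^ 'n ^ 'm" and b :: "real ^ 'm" and lam :: real and xbar :: "real ^ 'n"
    and J :: "'n set"
  assumes lam: "0 < lam"
    and inclusion: "0 \<in> lasso_map A b lam xbar"
    and J: "J = equicorrelation_set A b lam xbar"
    and rank: "full_column_rank_on A J"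
begin

abbreviation "T \<equiv> lasso_map A b lam"
abbreviation "g \<equiv> lasso_gradient A b lam"

lemma neg_gradient: "- g xbar \<in> subdifferential l1_norm xbar"
  using inclusion by (simp add: mem_lasso_map_iff)

lemma gradient_lt_1:
  assumes "i \<notin> J"
  shows "\<bar>g xbar $ i\<bar> < 1"
proof -
  have "\<bar>g xbar $ i\<bar> \<le> 1"
    using subdifferential_abs(1)[OF subdifferential_l1_norm_component[OF neg_gradient]] by simp
  moreover have "\<bar>g xbar $ i\<bar> \<noteq> 1"
    using assms lam by (auto simp: J equicorrelation_set_def lasso_gradient_component field_simps)
  ultimately show ?thesis by simp
qed

text \<open>Near \<open>(xbar, 0)\<close>, the points of the graph of \<open>T\<close> are supported in \<open>J\<close>.\<close>
lemma support_near_solution: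
  obtains e where "0 < e"
    "\<And>x u i. \<lbrakk>dist xbar x < e; norm u < e; u \<in> T x; i \<notin> J\<rbrakk> \<Longrightarrow> x $ i = 0"
proof -
  let ?N = "\<Inter>i\<in>-J. {z. \<bar>(snd z - g (fst z)) $ i\<bar> < 1}"
  have "open ?N"
    by (intro open_INT finite ballI open_Collect_less continuous_intros)
  moreover have "(xbar, 0) \<in> ?N"
    using gradient_lt_1 by auto
  ultimately obtain U V where UV: "open U" "open V" "(xbar, 0) \<in> U \<times> V" "U \<times> V \<subseteq> ?N"
    by (rule open_prod_elim)
  obtain d where d: "0 < d" "ball xbar d \<subseteq> U"
    using UV open_contains_ball by (metis mem_Sigma_iff)
  obtain e where e: "0 < e" "ball 0 e \<subseteq> V"
    using UV open_contains_ball by (metis mem_Sigma_iff)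
  show ?thesis
  proof
    show "0 < min d e"
      using d e by simp
    fix x u i
    assume *: "dist xbar x < min d e" "norm u < min d e" "u \<in> T x" "i \<notin> J"
    then have "(x, u) \<in> U \<times> V"
      using d e by (auto simp: subset_iff)
    then have "\<bar>(u - g x) $ i\<bar> < 1"
      using UV(4) \<open>i \<notin> J\<close> by force
    then show "x $ i = 0"
      using subdifferential_l1_norm_strict \<open>u \<in> T x\<close> unfolding mem_lasso_map_iff by blast
  qed
qed

text \<open>
  The increase of the objective from \<open>xbar\<close> to \<open>x\<close> is half the square of \<open>norm (A *v (x - xbar))\<close> plus
  \<open>lam\<close> times the sum of the terms \<open>\<bar>x $ i\<bar> + g xbar $ i * x $ i\<close>, all of which are nonnegative. If the
  increase is not positive, everything vanishes: then \<open>x - xbar\<close> lies in the kernel of \<open>A\<close> and, by the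
  terms with \<open>i \<notin> J\<close>, is supported in \<open>J\<close>.
\<close>
lemma solution_unique:
  assumes "lasso_objective A b lam x \<le> lasso_objective A b lam xbar"
  shows "x = xbar"
proof -
  let ?t = "\<lambda>i. \<bar>x $ i\<bar> + g xbar $ i * x $ i"
  have xb: "g xbar $ i * xbar $ i = - \<bar>xbar $ i\<bar>" for i
    using subdifferential_abs(2)[OF subdifferential_l1_norm_component[OF neg_gradient, of i]] by simp
  have le1: "\<bar>g xbar $ i\<bar> \<le> 1" for i
    using subdifferential_abs(1)[OF subdifferential_l1_norm_component[OF neg_gradient, of i]] by simp
  have t_nonneg: "0 \<le> ?t i" for i
  proof -
    have "\<bar>g xbar $ i * x $ i\<bar> \<le> 1 * \<bar>x $ i\<bar>"
      unfolding abs_mult by (intro mult_right_mono le1) simp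
    then show ?thesis by linarith
  qed
  have "inner (g xbar) (x - xbar) + (l1_norm x - l1_norm xbar) = (\<Sum>i\<in>UNIV. ?t i)"
    by (simp add: inner_vec_def l1_norm_def xb right_diff_distrib sum.distrib sum_subtractf sum_negf)
  moreover have "lasso_objective A b lam (xbar + (x - xbar)) \<le> lasso_objective A b lam xbar"
    using assms by simp
  ultimately have "lam * (\<Sum>i\<in>UNIV. ?t i) + (norm (A *v (x - xbar)))\<^sup>2 / 2 \<le> 0"
    using lam by (subst (asm) lasso_objective_add) (auto simp: distrib_left[symmetric] add.assoc)
  moreover have "0 \<le> lam * (\<Sum>i\<in>UNIV. ?t i)"
    using lam t_nonneg by (intro mult_nonneg_nonneg sum_nonneg) auto
  moreover have "0 \<le> (norm (A *v (x - xbar)))\<^sup>2" by simp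
  ultimately have "(norm (A *v (x - xbar)))\<^sup>2 = 0" "lam * (\<Sum>i\<in>UNIV. ?t i) = 0"
    by linarith+
  then have Ax: "A *v (x - xbar) = 0" and sum0: "(\<Sum>i\<in>UNIV. ?t i) = 0"
    using lam by simp_all
  have t0: "?t i = 0" for i
    using sum_nonneg_eq_0_iff[of UNIV ?t] t_nonneg sum0 by auto
  have "(x - xbar) $ i = 0" if "i \<notin> J" for i
  proof -
    have "\<bar>x $ i\<bar> = \<bar>g xbar $ i\<bar> * \<bar>x $ i\<bar>"
      using t0[of i] by (metis abs_abs abs_minus_cancel abs_mult add_eq_0_iff2)
    then have "x $ i = 0"
      using gradient_lt_1[OF that] by auto
    moreover have "xbar $ i = 0"
      using gradient_lt_1[OF that] subdifferential_l1_norm_strict[OF neg_gradient] by simp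
    ultimately show ?thesis by simp
  qed
  then have "x - xbar = 0"
    using full_column_rank_on_kernel[OF rank _ Ax] by blast
  then show ?thesis by simp
qed

lemma continuous_on_objective:
  "continuous_on S (\<lambda>x. lasso_objective A b lam x - lam * inner u x)"
  unfolding lasso_objective_def
  by (intro continuous_intros matrix_vector_mult_linear_continuous_on)

text \<open>
  Small perturbations \<open>u\<close> of the inclusion remain solvable close to \<open>xbar\<close>. With \<open>\<delta>\<close> the least increase
  of the objective on the sphere of radius \<open>r\<close>, the linear term changes the comparison with \<open>xbar\<close> by
  at most \<open>lam * norm u * r\<close>, which is less than \<open>\<delta>\<close>.
\<close>
lemma perturbed_solution:
  assumes "0 < r"
  obtains e where "0 < e" "\<And>u. norm u < e \<Longrightarrow> \<exists>x. dist xbar x < r \<and> u \<in> T x"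
proof -
  let ?F = "lasso_objective A b lam"
  have cont: "continuous_on S ?F" for S
    using continuous_on_objective[of S 0] by simp
  have ne: "sphere xbar r \<noteq> {}"
    using \<open>0 < r\<close> by simp
  obtain s where s: "s \<in> sphere xbar r" "\<And>y. y \<in> sphere xbar r \<Longrightarrow> ?F s \<le> ?F y"
    using continuous_attains_inf[OF compact_sphere ne cont] by blast
  define \<delta> where "\<delta> = ?F s - ?F xbar"
  have "s \<noteq> xbar"
    using s(1) \<open>0 < r\<close> by auto
  then have \<delta>: "0 < \<delta>"
    using solution_unique[of s] unfolding \<delta>_def by fastforce
  show ?thesis
  proof
    show "0 < \<delta> / (lam * r)"
      using \<delta> lam \<open>0 < r\<close> by simp
    fix u :: "real ^ 'n"
    assume u: "norm u < \<delta> / (lam * r)"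
    let ?G = "\<lambda>x. ?F x - lam * inner u x"
    have "cball xbar r \<noteq> {}"
      using \<open>0 < r\<close> by simp
    then obtain x where x: "x \<in> cball xbar r" "\<And>y. y \<in> cball xbar r \<Longrightarrow> ?G x \<le> ?G y"
      using continuous_attains_inf[OF compact_cball _ continuous_on_objective] by blast
    have "x \<notin> sphere xbar r"
    proof
      assume sph: "x \<in> sphere xbar r"
      have "\<delta> \<le> ?F x - ?F xbar"
        using s(2)[OF sph] by (simp add: \<delta>_def)
      also have "\<dots> \<le> lam * inner u (x - xbar)"
        using x(2)[of xbar] \<open>0 < r\<close> by (simp add: inner_diff_right right_diff_distrib)
      also have "\<dots> \<le> lam * (norm u * r)"
        using lam norm_cauchy_schwarz[of u "x - xbar"] sph
        by (simp add: dist_norm norm_minus_commute)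
      also have "\<dots> < \<delta>"
        using u lam \<open>0 < r\<close> by (simp add: field_simps)
      finally show False by simp
    qed
    then have "x \<in> ball xbar r"
      using x(1) by auto
    then obtain e where e: "0 < e" "ball x e \<subseteq> ball xbar r"
      using open_contains_ball open_ball by blast
    have "u \<in> T x"
      using x(2) e by (intro lasso_map_of_local_minimum[OF lam \<open>0 < e\<close>]) (auto simp: subset_iff)
    then show "\<exists>x. dist xbar x < r \<and> u \<in> T x"
      using \<open>x \<in> ball xbar r\<close> by auto
  qed
qed

proposition metrically_regular_at_solution: "metrically_regular T xbar 0"
proof -
  obtain c where c: "0 < c" "\<And>x. (\<And>i. i \<notin> J \<Longrightarrow> x $ i = 0) \<Longrightarrow> c * norm x \<le> norm (A *v x)"
    using full_column_rank_on_bounded_below[OF rank] by blast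
  obtain \<eta> where \<eta>: "0 < \<eta>"
    "\<And>x u i. \<lbrakk>dist xbar x < \<eta>; norm u < \<eta>; u \<in> T x; i \<notin> J\<rbrakk> \<Longrightarrow> x $ i = 0"
    using support_near_solution by blast
  obtain \<epsilon> where \<epsilon>: "0 < \<epsilon>" "\<And>u. norm u < \<epsilon> \<Longrightarrow> \<exists>x. dist xbar x < \<eta> / 2 \<and> u \<in> T x"
    using perturbed_solution[of "\<eta> / 2"] \<eta>(1) by auto
  \<comment> \<open>The constant \<open>lam / c\<^sup>2\<close> serves the values \<open>v \<in> T x\<close> with \<open>norm v < \<eta>\<close>. All others are at distance
      at least \<open>\<eta> / 2\<close> from \<open>u\<close>, whereas \<open>x\<close> and the solution \<open>y\<close> for \<open>u\<close> differ by at most \<open>\<eta>\<close>; there 2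
      is enough.\<close>
  define \<kappa> where "\<kappa> = max (lam / c\<^sup>2) 2"
  have \<kappa>: "0 < \<kappa>" by (simp add: \<kappa>_def)
  have "set_distance x (inverse_map T u) \<le> ereal \<kappa> * set_distance u (T x)"
    if x: "x \<in> ball xbar (\<eta> / 2)" and u: "u \<in> ball 0 (min \<epsilon> (\<eta> / 2))" for x u
  proof -
    obtain y where y: "dist xbar y < \<eta> / 2" "u \<in> T y"
      using \<epsilon>(2)[of u] u by auto
    have bound: "dist x y \<le> \<kappa> * dist u v" if v: "v \<in> T x" for v
    proof (cases "norm v < \<eta>")
      case True
      have "(x - y) $ i = 0" if "i \<notin> J" for i
        using \<eta>(2)[of x v i] \<eta>(2)[of y u i] True that x y v u \<eta>(1) by auto
      then have "c * norm (x - y) \<le> norm (A *v (x - y))"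
        by (rule c(2))
      then have "(c * norm (x - y))\<^sup>2 \<le> (norm (A *v (x - y)))\<^sup>2"
        using c(1) by (intro power_mono) auto
      also have "\<dots> \<le> lam * inner (v - u) (x - y)"
        using lasso_map_monotone[OF lam v y(2)] .
      also have "\<dots> \<le> lam * (dist u v * norm (x - y))"
        using lam norm_cauchy_schwarz[of "v - u" "x - y"]
        by (simp add: dist_norm norm_minus_commute)
      finally have *: "(c\<^sup>2 * norm (x - y)) * norm (x - y) \<le> (lam * dist u v) * norm (x - y)"
        by (simp add: power_mult_distrib power2_eq_square mult_ac)
      have "dist x y \<le> lam / c\<^sup>2 * dist u v"
      proof (cases "x = y")
        case False
        with * have "c\<^sup>2 * norm (x - y) \<le> lam * dist u v"
          by (subst (asm) mult_le_cancel_right) auto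
        then show ?thesis
          using c(1) by (simp add: dist_norm field_simps)
      qed (use lam in simp)
      also have "\<dots> \<le> \<kappa> * dist u v"
        by (intro mult_right_mono) (auto simp: \<kappa>_def)
      finally show ?thesis .
    next
      case False
      have "dist x y \<le> \<eta>"
        using x y(1) dist_triangle3[of x y xbar] by simp
      also have "\<dots> \<le> 2 * dist u v"
        using False u norm_triangle_ineq2[of v u] by (simp add: dist_norm norm_minus_commute)
      also have "\<dots> \<le> \<kappa> * dist u v"
        by (intro mult_right_mono) (auto simp: \<kappa>_def)
      finally show ?thesis .
    qed
    have "set_distance x (inverse_map T u) \<le> ereal (dist x y)"
      using y(2) unfolding set_distance_def inverse_map_def by (intro INF_lower) simp
    also have "\<dots> = ereal \<kappa> * ereal (dist x y / \<kappa>)"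
      using \<kappa> by simp
    also have "\<dots> \<le> ereal \<kappa> * set_distance u (T x)"
      using bound \<kappa> unfolding set_distance_def
      by (intro ereal_mult_left_mono INF_greatest) (auto simp: field_simps)
    finally show ?thesis .
  qed
  moreover have "(xbar, 0) \<in> graph_of T"
    using inclusion by (simp add: graph_of_def)
  ultimately show ?thesis
    unfolding metrically_regular_def using \<eta>(1) \<epsilon>(1) \<kappa>
    by (intro conjI exI[of _ "ball xbar (\<eta> / 2)"] exI[of _ "ball 0 (min \<epsilon> (\<eta> / 2))"]
        exI[of _ \<kappa>]) auto
qed

end

theorem proposition4p12:
  fixes A :: "real ^ 'n ^ 'm" and b :: "real ^ 'm" and lam :: real and xbar :: "real ^ 'n"
    and J :: "'n set" and T :: "real ^ 'n \<Rightarrow> (real ^ 'n) set"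
  assumes "0 < lam"
    and "is_arg_min (lasso_objective A b lam) (\<lambda>_. True) xbar"
    and "J = equicorrelation_set A b lam xbar"
    and "T = lasso_map A b lam"
  shows "closed (graph_of T) \<and>
    (full_column_rank_on A J \<longrightarrow>
       ker_coderivative T xbar 0 = {0} \<and> metrically_regular T xbar 0)"
proof (intro conjI impI)
  show "closed (graph_of T)"
    using closed_graph_lasso_map assms(4) by simp
next
  assume rank: "full_column_rank_on A J"
  have "0 \<in> lasso_map A b lam xbar"
    using assms(1,2)
    by (intro lasso_map_of_local_minimum[of _ 1]) (auto simp: is_arg_min_linorder)
  then interpret lasso_solution A b lam xbar J
    using assms rank by unfold_locales
  show "metrically_regular T xbar 0"
    using metrically_regular_at_solution assms(4) by simp
  then show "ker_coderivative T xbar 0 = {0}"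
    by (rule ker_coderivative_of_metrically_regular)
qed

end
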